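(* Let $(I,\Sigma)$ be a $\sigma$-filtered pair. Then for every 1-cell $d : i \to i'$ of $I$ there exist an object $j$ of $I$, 1-cells $s : i \to j$ and $s' : i' \to j$ both in $\Sigma$, and a (not necessarily invertible) 2-cell $\phi : s' d \Rightarrow s$.
   Context: A 2-category means a strict 2-category. Let $I$ be a 2-category and $\Sigma$ a class of 1-cells of $I$ which contains the equivalences and is closed under composition and under invertible 2-cells (any 1-cell isomorphic to one in $\Sigma$ is in $\Sigma$). The pair $(I,\Sigma)$ is a $\sigma$-filtered pair if: (1) for any objects $i,i'$ of $I$ there are an object $i''$ and 1-cells $s : i \to i''$, $s' : i' \to i''$ both in $\Sigma$; (2) for any parallel pair of 1-cells $d,s : i \rightrightarrows i'$ with $s\in\Sigma$, there exist a 1-cell $t : i' \to i''$ in $\Sigma$ and a 2-cell $\alpha : td \Rightarrow ts$; moreover $\alpha$ can be chosen invertible whenever $d$ is also in $\Sigma$; (3) for any pair of parallel 2-cells $\alpha,\alpha' : d \Rightarrow s$ between 1-cells $d,s : i \to i'$ with $s \in \Sigma$, there exists $f : i' \to i''$ in $\Sigma$ such that the whiskerings satisfy $f*\alpha = f*\alpha'$. *)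

theory Defs
  imports Main
begin

locale category =
  fixes Ob :: "'o set" and Ar :: "'a set"
    and dom :: "'a \<Rightarrow> 'o" and cod :: "'a \<Rightarrow> 'o"
    and ide :: "'o \<Rightarrow> 'a" and comp :: "'a \<Rightarrow> 'a \<Rightarrow> 'a"
  assumes dom_closed: "f \<in> Ar \<Longrightarrow> dom f \<in> Ob"
    and cod_closed: "f \<in> Ar \<Longrightarrow> cod f \<in> Ob"
    and ide_closed: "x \<in> Ob \<Longrightarrow> ide x \<in> Ar"
    and dom_ide: "x \<in> Ob \<Longrightarrow> dom (ide x) = x"
    and cod_ide: "x \<in> Ob \<Longrightarrow> cod (ide x) = x"
    and comp_closed: "\<lbrakk>f \<in> Ar; g \<in> Ar; cod f = dom g\<rbrakk> \<Longrightarrow> comp g f \<in> Ar"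
    and dom_comp: "\<lbrakk>f \<in> Ar; g \<in> Ar; cod f = dom g\<rbrakk> \<Longrightarrow> dom (comp g f) = dom f"
    and cod_comp: "\<lbrakk>f \<in> Ar; g \<in> Ar; cod f = dom g\<rbrakk> \<Longrightarrow> cod (comp g f) = cod g"
    and comp_assoc: "\<lbrakk>f \<in> Ar; g \<in> Ar; h \<in> Ar; cod f = dom g; cod g = dom h\<rbrakk>
      \<Longrightarrow> comp (comp h g) f = comp h (comp g f)"
    and comp_ide_right: "f \<in> Ar \<Longrightarrow> comp f (ide (dom f)) = f"
    and comp_ide_left: "f \<in> Ar \<Longrightarrow> comp (ide (cod f)) f = f"

record ('o, 'a, 'c) two_cells =
  Obj :: "'o set"
  Cells1 :: "'a set"
  Cells2 :: "'c set"
  src :: "'a \<Rightarrow> 'o"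
  trg :: "'a \<Rightarrow> 'o"
  unit1 :: "'o \<Rightarrow> 'a"
  comp1 :: "'a \<Rightarrow> 'a \<Rightarrow> 'a"  (infixr \<open>\<cdot>\<index>\<close> 70)
  dom2 :: "'c \<Rightarrow> 'a"
  cod2 :: "'c \<Rightarrow> 'a"
  unit2 :: "'a \<Rightarrow> 'c"
  vcomp :: "'c \<Rightarrow> 'c \<Rightarrow> 'c"  (infixr \<open>\<bullet>\<index>\<close> 65)
  hcomp :: "'c \<Rightarrow> 'c \<Rightarrow> 'c"  (infixr \<open>\<star>\<index>\<close> 70)

text \<open>
  All compositions are written in applicative order: the second argument comes first.
  A strict 2-category has a category of objects and 1-cells, a category of 1-cells and 2-cells
  (vertical composition; the disjoint union of the hom-categories), and a category of objects
  and 2-cells (horizontal composition). The laws \<open>dom2_hcomp\<close>, \<open>cod2_hcomp\<close>,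
  \<open>hcomp_unit2\<close> and \<open>interchange\<close> say that horizontal composition is a functor on
  hom-categories.
\<close>

locale strict_2_category =
  cells1: category "Obj C" "Cells1 C" "src C" "trg C" "unit1 C" "comp1 C" +
  vert: category "Cells1 C" "Cells2 C" "dom2 C" "cod2 C" "unit2 C" "vcomp C" +
  horiz: category "Obj C" "Cells2 C" "\<lambda>\<alpha>. src C (dom2 C \<alpha>)" "\<lambda>\<alpha>. trg C (dom2 C \<alpha>)"
    "\<lambda>x. unit2 C (unit1 C x)" "hcomp C"
  for C (structure) +
  assumes src_cod2: "\<alpha> \<in> Cells2 C \<Longrightarrow> src C (cod2 C \<alpha>) = src C (dom2 C \<alpha>)"
    and trg_cod2: "\<alpha> \<in> Cells2 C \<Longrightarrow> trg C (cod2 C \<alpha>) = trg C (dom2 C \<alpha>)"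
    and dom2_hcomp: "\<lbrakk>\<alpha> \<in> Cells2 C; \<beta> \<in> Cells2 C; trg C (dom2 C \<alpha>) = src C (dom2 C \<beta>)\<rbrakk>
      \<Longrightarrow> dom2 C (\<beta> \<star> \<alpha>) = dom2 C \<beta> \<cdot> dom2 C \<alpha>"
    and cod2_hcomp: "\<lbrakk>\<alpha> \<in> Cells2 C; \<beta> \<in> Cells2 C; trg C (dom2 C \<alpha>) = src C (dom2 C \<beta>)\<rbrakk>
      \<Longrightarrow> cod2 C (\<beta> \<star> \<alpha>) = cod2 C \<beta> \<cdot> cod2 C \<alpha>"
    and hcomp_unit2: "\<lbrakk>f \<in> Cells1 C; g \<in> Cells1 C; trg C f = src C g\<rbrakk>
      \<Longrightarrow> unit2 C g \<star> unit2 C f = unit2 C (g \<cdot> f)"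
    and interchange: "\<lbrakk>\<alpha> \<in> Cells2 C; \<alpha>' \<in> Cells2 C; \<beta> \<in> Cells2 C; \<beta>' \<in> Cells2 C;
        cod2 C \<alpha> = dom2 C \<alpha>'; cod2 C \<beta> = dom2 C \<beta>'; trg C (dom2 C \<alpha>) = src C (dom2 C \<beta>)\<rbrakk>
      \<Longrightarrow> (\<beta>' \<bullet> \<beta>) \<star> (\<alpha>' \<bullet> \<alpha>) = (\<beta>' \<star> \<alpha>') \<bullet> (\<beta> \<star> \<alpha>)"

definition hom1 :: "('o, 'a, 'c, 'm) two_cells_scheme \<Rightarrow> 'o \<Rightarrow> 'o \<Rightarrow> 'a set" where
  "hom1 C x y = {f \<in> Cells1 C. src C f = x \<and> trg C f = y}"

definition hom2 :: "('o, 'a, 'c, 'm) two_cells_scheme \<Rightarrow> 'a \<Rightarrow> 'a \<Rightarrow> 'c set" where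
  "hom2 C f g = {\<alpha> \<in> Cells2 C. dom2 C \<alpha> = f \<and> cod2 C \<alpha> = g}"

definition invertible2 :: "('o, 'a, 'c, 'm) two_cells_scheme \<Rightarrow> 'c \<Rightarrow> bool" where
  "invertible2 C \<alpha> \<longleftrightarrow> \<alpha> \<in> Cells2 C \<and>
    (\<exists>\<beta> \<in> hom2 C (cod2 C \<alpha>) (dom2 C \<alpha>).
      \<beta> \<bullet>\<^bsub>C\<^esub> \<alpha> = unit2 C (dom2 C \<alpha>) \<and> \<alpha> \<bullet>\<^bsub>C\<^esub> \<beta> = unit2 C (cod2 C \<alpha>))"

definition iso1 :: "('o, 'a, 'c, 'm) two_cells_scheme \<Rightarrow> 'a \<Rightarrow> 'a \<Rightarrow> bool" where
  "iso1 C f g \<longleftrightarrow> (\<exists>\<alpha> \<in> hom2 C f g. invertible2 C \<alpha>)"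

definition equivalence1 :: "('o, 'a, 'c, 'm) two_cells_scheme \<Rightarrow> 'a \<Rightarrow> bool" where
  "equivalence1 C f \<longleftrightarrow> f \<in> Cells1 C \<and>
    (\<exists>g \<in> hom1 C (trg C f) (src C f).
      iso1 C (g \<cdot>\<^bsub>C\<^esub> f) (unit1 C (src C f)) \<and> iso1 C (f \<cdot>\<^bsub>C\<^esub> g) (unit1 C (trg C f)))"

definition whisker :: "('o, 'a, 'c, 'm) two_cells_scheme \<Rightarrow> 'a \<Rightarrow> 'c \<Rightarrow> 'c" where
  "whisker C f \<alpha> = unit2 C f \<star>\<^bsub>C\<^esub> \<alpha>"

locale sigma_filtered_pair = strict_2_category C
  for C (structure) and \<Sigma> +
  assumes Sigma_subset: "\<Sigma> \<subseteq> Cells1 C"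
    and Sigma_equivalence: "equivalence1 C f \<Longrightarrow> f \<in> \<Sigma>"
    and Sigma_comp: "\<lbrakk>f \<in> \<Sigma>; g \<in> \<Sigma>; trg C f = src C g\<rbrakk> \<Longrightarrow> g \<cdot> f \<in> \<Sigma>"
    and Sigma_iso: "\<lbrakk>f \<in> \<Sigma>; iso1 C f g\<rbrakk> \<Longrightarrow> g \<in> \<Sigma>"
    and filtered_objects: "\<lbrakk>i \<in> Obj C; i' \<in> Obj C\<rbrakk>
      \<Longrightarrow> \<exists>i'' \<in> Obj C. \<exists>s \<in> hom1 C i i''. \<exists>s' \<in> hom1 C i' i''. s \<in> \<Sigma> \<and> s' \<in> \<Sigma>"
    and filtered_1cells: "\<lbrakk>i \<in> Obj C; i' \<in> Obj C; d \<in> hom1 C i i'; s \<in> hom1 C i i'; s \<in> \<Sigma>\<rbrakk>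
      \<Longrightarrow> \<exists>i'' \<in> Obj C. \<exists>t \<in> hom1 C i' i''. \<exists>\<alpha> \<in> hom2 C (t \<cdot> d) (t \<cdot> s).
            t \<in> \<Sigma> \<and> (d \<in> \<Sigma> \<longrightarrow> invertible2 C \<alpha>)"
    and filtered_2cells: "\<lbrakk>i \<in> Obj C; i' \<in> Obj C; d \<in> hom1 C i i'; s \<in> hom1 C i i'; s \<in> \<Sigma>;
        \<alpha> \<in> hom2 C d s; \<alpha>' \<in> hom2 C d s\<rbrakk>
      \<Longrightarrow> \<exists>i'' \<in> Obj C. \<exists>f \<in> hom1 C i' i''. f \<in> \<Sigma> \<and> whisker C f \<alpha> = whisker C f \<alpha>'"

end

theory Submission
  imports Defs
begin

text \<open>Axiom (2) compares a 1-cell only with a parallel one in \<open>\<Sigma>\<close>, and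
  \<open>d\<close> need not have such a partner. Axiom (1) supplies one after postcomposition: a
  cospan \<open>u\<close>, \<open>u'\<close> in \<open>\<Sigma>\<close> from \<open>i\<close> and
  \<open>i'\<close> makes \<open>u' \<cdot> d\<close> parallel to \<open>u\<close>. Axiom (2) then
  gives \<open>t\<close> in \<open>\<Sigma>\<close> and a 2-cell from
  \<open>t \<cdot> (u' \<cdot> d)\<close> to \<open>t \<cdot> u\<close>, so
  \<open>s = t \<cdot> u\<close> and \<open>s' = t \<cdot> u'\<close> work.\<close>

theorem lemma2p1p10:
  fixes C :: "('o, 'a, 'c, 'm) two_cells_scheme" and \<Sigma> :: "'a set"
    and i i' :: 'o and d :: 'a
  assumes "sigma_filtered_pair C \<Sigma>"
    and "i \<in> Obj C" and "i' \<in> Obj C" and "d \<in> hom1 C i i'"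
  shows "\<exists>j \<in> Obj C. \<exists>s \<in> hom1 C i j. \<exists>s' \<in> hom1 C i' j. \<exists>\<phi> \<in> hom2 C (s' \<cdot>\<^bsub>C\<^esub> d) s.
           s \<in> \<Sigma> \<and> s' \<in> \<Sigma>"
proof -
  interpret sigma_filtered_pair C \<Sigma> by fact
  have comp_hom1: "g \<cdot>\<^bsub>C\<^esub> f \<in> hom1 C x z" if "f \<in> hom1 C x y" "g \<in> hom1 C y z" for f g x y z
    using that by (simp add: hom1_def cells1.comp_closed cells1.dom_comp cells1.cod_comp)
  have comp_Sigma: "g \<cdot>\<^bsub>C\<^esub> f \<in> \<Sigma>"
    if "f \<in> hom1 C x y" "g \<in> hom1 C y z" "f \<in> \<Sigma>" "g \<in> \<Sigma>" for f g x y z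
    using that by (simp add: hom1_def Sigma_comp)
  obtain k u u' where k: "k \<in> Obj C" and u: "u \<in> hom1 C i k" "u \<in> \<Sigma>"
    and u': "u' \<in> hom1 C i' k" "u' \<in> \<Sigma>"
    using filtered_objects[OF assms(2,3)] by blast
  \<comment> \<open>Here \<open>u\<close> is the member of the parallel pair known to lie in
    \<open>\<Sigma>\<close>; as \<open>d\<close> is arbitrary, \<open>u' \<cdot> d\<close> may lie
    outside it, so \<open>\<alpha>\<close> need not be invertible.\<close>
  obtain j t \<alpha> where j: "j \<in> Obj C" and t: "t \<in> hom1 C k j" "t \<in> \<Sigma>"
    and \<alpha>: "\<alpha> \<in> hom2 C (t \<cdot>\<^bsub>C\<^esub> (u' \<cdot>\<^bsub>C\<^esub> d)) (t \<cdot>\<^bsub>C\<^esub> u)"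
    using filtered_1cells[OF assms(2) k comp_hom1[OF assms(4) u'(1)] u] by blast
  \<comment> \<open>By strictness, rebracketing is an equality of 1-cells, so
    \<open>\<alpha>\<close> itself serves as \<phi>, with no associator to paste on.\<close>
  have "(t \<cdot>\<^bsub>C\<^esub> u') \<cdot>\<^bsub>C\<^esub> d = t \<cdot>\<^bsub>C\<^esub> (u' \<cdot>\<^bsub>C\<^esub> d)"
    using assms(4) u'(1) t(1) by (simp add: hom1_def cells1.comp_assoc)
  with \<alpha> have "\<alpha> \<in> hom2 C ((t \<cdot>\<^bsub>C\<^esub> u') \<cdot>\<^bsub>C\<^esub> d) (t \<cdot>\<^bsub>C\<^esub> u)"
    by simp
  moreover have "t \<cdot>\<^bsub>C\<^esub> u \<in> hom1 C i j" "t \<cdot>\<^bsub>C\<^esub> u' \<in> hom1 C i' j"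
    using u(1) u'(1) t(1) by (blast intro: comp_hom1)+
  moreover have "t \<cdot>\<^bsub>C\<^esub> u \<in> \<Sigma>" "t \<cdot>\<^bsub>C\<^esub> u' \<in> \<Sigma>"
    using u u' t by (blast intro: comp_Sigma)+
  ultimately show ?thesis
    using j by blast
qed

end
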